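(* For every integer $k\ge 0$, $1.5^k\le M_{k,\mathrm{T}\cdots\mathrm{T}}\le \mathrm{Fib}_{k+2}$.
   Context: Unordered CNF game: an instance is a pair $(\varphi,X)$ where $\varphi$ is a CNF formula (a set of clauses, each clause a disjunction of literals $x_i$ or $\overline{x}_i$) and $X$ is a finite set of boolean variables containing every variable appearing in $\varphi$ (and possibly more). Two players, T and F, alternate turns; on each turn the player picks a not-yet-assigned variable from $X$ and assigns it the value $0$ or $1$ of their choice. The game ends when all variables of $X$ are assigned; T wins if $\varphi$ is satisfied and F wins otherwise. If the same player moves first and last then $|X|$ is odd. A CNF is $k$-uniform if every clause has exactly $k$ literals, on $k$ distinct variables. For $k\ge 0$ and $a,b\in\{\mathrm{T},\mathrm{F}\}$, $M_{k,a\cdots b}$ denotes the minimum number of clauses of $\varphi$ over all instances $(\varphi,X)$ with $\varphi$ $k$-uniform such that F has a winning strategy when player $a$ makes the first move and player $b$ makes the last move. $\mathrm{Fib}_n$ is the $n$-th Fibonacci number, with $\mathrm{Fib}_1=\mathrm{Fib}_2=1$ and $\mathrm{Fib}_{n}=\mathrm{Fib}_{n-1}+\mathrm{Fib}_{n-2}$. *)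

theory Defs
  imports Complex_Main "HOL-Number_Theory.Fib"
begin

datatype player = PlayerT | PlayerF

fun opponent :: "player \<Rightarrow> player" where
  "opponent PlayerT = PlayerF"
| "opponent PlayerF = PlayerT"

text \<open>The literal \<open>(x, b)\<close> is made true by giving \<open>x\<close> the value \<open>b\<close>; so \<open>(x, True)\<close> is the
  positive and \<open>(x, False)\<close> the negated literal. A clause is the disjunction of its literals,
  a CNF formula the conjunction of its clauses.\<close>

type_synonym literal = "nat \<times> bool"
type_synonym clause = "literal set"
type_synonym cnf = "clause set"

definition cnf_vars :: "cnf \<Rightarrow> nat set" where
  "cnf_vars \<phi> = fst ` \<Union>\<phi>"

definition satisfies :: "(nat \<Rightarrow> bool) \<Rightarrow> cnf \<Rightarrow> bool" where
  "satisfies \<alpha> \<phi> \<longleftrightarrow> (\<forall>C\<in>\<phi>. \<exists>(x, b)\<in>C. \<alpha> x = b)"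

definition k_uniform :: "nat \<Rightarrow> cnf \<Rightarrow> bool" where
  "k_uniform k \<phi> \<longleftrightarrow> (\<forall>C\<in>\<phi>. finite C \<and> card C = k \<and> card (fst ` C) = k)"

text \<open>Finiteness of \<open>\<phi>\<close> and of its clauses follows from \<open>cnf_vars \<phi> \<subseteq> X\<close>.\<close>

definition game_instance :: "cnf \<Rightarrow> nat set \<Rightarrow> bool" where
  "game_instance \<phi> X \<longleftrightarrow> finite X \<and> cnf_vars \<phi> \<subseteq> X"

text \<open>A move assigns a value to a variable. Plays list the moves in chronological order; they
  may be unfinished.\<close>

type_synonym move = "nat \<times> bool"

definition legal_play :: "nat set \<Rightarrow> move list \<Rightarrow> bool" where
  "legal_play X h \<longleftrightarrow> distinct (map fst h) \<and> fst ` set h \<subseteq> X"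

definition complete_play :: "nat set \<Rightarrow> move list \<Rightarrow> bool" where
  "complete_play X h \<longleftrightarrow> legal_play X h \<and> fst ` set h = X"

definition assignment_of :: "move list \<Rightarrow> nat \<Rightarrow> bool" where
  "assignment_of h x \<longleftrightarrow> (x, True) \<in> set h"

text \<open>The player making move number \<open>i\<close>, counted from 0, when player \<open>a\<close> moves first.\<close>

definition mover :: "player \<Rightarrow> nat \<Rightarrow> player" where
  "mover a i = (if even i then a else opponent a)"

type_synonym strategy = "move list \<Rightarrow> move"

definition legal_strategy :: "nat set \<Rightarrow> player \<Rightarrow> player \<Rightarrow> strategy \<Rightarrow> bool" where
  "legal_strategy X a p \<sigma> \<longleftrightarrow>
     (\<forall>h. legal_play X h \<and> \<not> complete_play X h \<and> mover a (length h) = p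
          \<longrightarrow> fst (\<sigma> h) \<in> X - fst ` set h)"

definition follows :: "player \<Rightarrow> player \<Rightarrow> strategy \<Rightarrow> move list \<Rightarrow> bool" where
  "follows a p \<sigma> h \<longleftrightarrow> (\<forall>i<length h. mover a i = p \<longrightarrow> h ! i = \<sigma> (take i h))"

definition F_has_winning_strategy :: "cnf \<Rightarrow> nat set \<Rightarrow> player \<Rightarrow> bool" where
  "F_has_winning_strategy \<phi> X a \<longleftrightarrow>
     (\<exists>\<sigma>. legal_strategy X a PlayerF \<sigma> \<and>
          (\<forall>h. complete_play X h \<and> follows a PlayerF \<sigma> h
               \<longrightarrow> \<not> satisfies (assignment_of h) \<phi>))"

text \<open>The infimum in \<open>nat\<close> of a nonempty set is its minimum. Since \<open>Inf {} = 0\<close>, a positive lower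
  bound on \<open>min_clauses k a b\<close> also entails that the set is nonempty.\<close>

definition min_clauses :: "nat \<Rightarrow> player \<Rightarrow> player \<Rightarrow> nat" where
  "min_clauses k a b =
     Inf {card \<phi> | \<phi> X. game_instance \<phi> X \<and> k_uniform k \<phi> \<and>
            X \<noteq> {} \<and> mover a (card X - 1) = b \<and>
            F_has_winning_strategy \<phi> X a}"

end

(* Lower bound: give a clause with c literals weight (2/3)^c, so that the total is below 1 if there
   are fewer than 1.5^k clauses. T keeps the total from growing over each pair of moves, either by
   setting a literal of greatest expected gain, or, where clauses such as l | -m and -l | m punish
   whoever moves first on their variables, by setting a pair of variables aside and always
   answering F so that l = m.
   Upper bound: (x | phi) & (-x | y | psi) with phi of width k-1 and psi of width k-2 on disjoint
   variables turns the Fibonacci recursion into a game. *)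
theory Submission
  imports Defs
begin

section \<open>Winning positions\<close>

text \<open>Strategies that read the whole history do not suit induction, so both bounds are proved
  for \<open>wins\<close>, with T as hero in one and F in the other, and are then carried over to
  plays. The obstacle in the lower bound is a pair of clauses \<open>{l, m}\<close> and
  \<open>{neg l, neg m}\<close> of weight w each. All four literals gain equally, yet whichever one
  T sets, F falsifies the other literal of the clause that T has shortened, and 2w becomes 9/4 w.
  Identifying \<open>l\<close> with \<open>neg m\<close> deletes both clauses at a price of 3/2 per
  variable in the others. Such a pair can be set aside because T moves last, so T never has to open
  it. In the upper bound a move by F is the currency. As soon as T leaves the \<open>\<phi>\<close>
  game, F has a free reply and spends it on \<open>x := False\<close>. Only \<open>x := True\<close>
  by T spoils this, and then \<open>\<psi>\<close> must again be started by T: the literal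
  \<open>y\<close> gives F a reply to make. That literal is why \<open>\<psi>\<close> has width
  k-2.\<close>

text \<open>\<open>wins b X W\<close>: a distinguished player (the hero), who is to move iff \<open>b\<close>, can enforce \<open>W\<close>
  when the variables in \<open>X\<close> are still free. Played values are substituted into \<open>W\<close>.\<close>

inductive wins :: "bool \<Rightarrow> nat set \<Rightarrow> ((nat \<Rightarrow> bool) \<Rightarrow> bool) \<Rightarrow> bool" where
  finished: "(\<And>\<alpha>. W \<alpha>) \<Longrightarrow> wins b {} W"
| hero: "x \<in> X \<Longrightarrow> wins False (X - {x}) (\<lambda>\<alpha>. W (\<alpha>(x := v))) \<Longrightarrow> wins True X W"
| opp: "X \<noteq> {} \<Longrightarrow> (\<And>x v. x \<in> X \<Longrightarrow> wins True (X - {x}) (\<lambda>\<alpha>. W (\<alpha>(x := v)))) \<Longrightarrow> wins False X W"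

lemma wins_empty: "wins b {} W \<Longrightarrow> W \<alpha>"
  by (auto elim: wins.cases)

lemma wins_True_D:
  "wins True X W \<Longrightarrow> X \<noteq> {} \<Longrightarrow> \<exists>x\<in>X. \<exists>v. wins False (X - {x}) (\<lambda>\<alpha>. W (\<alpha>(x := v)))"
  by (auto elim: wins.cases)

lemma wins_False_D:
  "wins False X W \<Longrightarrow> x \<in> X \<Longrightarrow> wins True (X - {x}) (\<lambda>\<alpha>. W (\<alpha>(x := v)))"
  by (auto elim: wins.cases)

lemma wins_mono:
  assumes "wins b X W" "\<And>\<alpha>. W \<alpha> \<Longrightarrow> W' \<alpha>"
  shows "wins b X W'"
  using assms
proof (induction b X W arbitrary: W' rule: wins.induct)
  case (finished W b)
  then show ?case by (auto intro: wins.finished)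
next
  case (hero x X W v)
  show ?case by (rule wins.hero[OF hero.hyps(1) hero.IH]) (rule hero.prems)
next
  case (opp X W)
  show ?case
    by (rule wins.opp[OF opp.hyps(1)], rule opp.IH, assumption, rule opp.prems)
qed

lemma wins_always:
  assumes "finite X" "\<And>\<alpha>. W \<alpha>"
  shows "wins b X W"
  using assms
proof (induction "card X" arbitrary: X W b)
  case 0
  then show ?case by (auto intro: wins.finished)
next
  case (Suc n)
  then have "X \<noteq> {}" by auto
  then obtain x where "x \<in> X" by auto
  have *: "wins b' (X - {y}) (\<lambda>\<alpha>. W (\<alpha>(y := v)))" if "y \<in> X" for b' y v
    using Suc.hyps(2) Suc.prems(1) that by (intro Suc.hyps(1) Suc.prems(2)) simp_all
  show ?case
  proof (cases b)
    case True
    then show ?thesis using wins.hero[OF \<open>x \<in> X\<close> *[OF \<open>x \<in> X\<close>]] by simp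
  next
    case False
    then show ?thesis using wins.opp[OF \<open>X \<noteq> {}\<close> *] by simp
  qed
qed

section \<open>Adding irrelevant or paired variables to a game\<close>

lemma fun_upd_rotate:
  "z \<noteq> x \<Longrightarrow> z \<noteq> y \<Longrightarrow> f(x := u, y := w, z := v) = f(z := v, x := u, y := w)"
  by auto

text \<open>The hero answers a move on \<open>x\<close> or \<open>y\<close> by a move on the other
  one, with an arbitrary value. If only the pair is left and the hero has to open it,
  \<open>W'\<close> already holds, so nothing can go wrong.\<close>

lemma wins_dummy_pair:
  assumes "wins b X W'" "finite X" "x \<notin> X" "y \<notin> X" "x \<noteq> y"
    "\<And>\<alpha> u v. W' \<alpha> \<Longrightarrow> W (\<alpha>(x := u, y := v))"
  shows "wins b (insert x (insert y X)) W"
  using assms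
proof (induction b X W' arbitrary: W rule: wins.induct)
  case (finished W' b)
  have "W \<alpha>" for \<alpha> using finished(6)[OF finished(1), of \<alpha> "\<alpha> x" "\<alpha> y"] by simp
  then show ?case by (intro wins_always) auto
next
  case (hero z X W' v)
  have "wins False (insert x (insert y (X - {z}))) (\<lambda>\<alpha>. W (\<alpha>(z := v)))"
  proof (rule hero.IH)
    fix \<alpha> u w assume "W' (\<alpha>(z := v))"
    from hero.prems(5)[OF this, of u w] show "W (\<alpha>(x := u, y := w, z := v))"
      using hero.hyps hero.prems by (subst fun_upd_rotate) (auto simp del: fun_upd_apply)
  qed (use hero in auto)
  moreover have "insert x (insert y (X - {z})) = insert x (insert y X) - {z}" using hero by auto
  ultimately show ?case using hero by (auto intro: wins.hero[of z _ _ v])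
next
  case (opp X W')
  have W': "wins False X W'" by (rule wins.opp) (use opp.hyps in auto)
  show ?case
  proof (rule wins.opp)
    fix z v assume z: "z \<in> insert x (insert y X)"
    then consider "z \<in> X" | "z = x" | "z = y" by auto
    then show "wins True (insert x (insert y X) - {z}) (\<lambda>\<alpha>. W (\<alpha>(z := v)))"
    proof cases
      case 1
      have "wins True (insert x (insert y (X - {z}))) (\<lambda>\<alpha>. W (\<alpha>(z := v)))"
      proof (rule opp.IH[OF 1, of v])
        fix \<alpha> u w assume "W' (\<alpha>(z := v))"
        from opp.prems(5)[OF this, of u w] show "W (\<alpha>(x := u, y := w, z := v))"
          using 1 opp.prems by (subst fun_upd_rotate) (auto simp del: fun_upd_apply)
      qed (use opp 1 in auto)
      moreover have "insert x (insert y (X - {z})) = insert x (insert y X) - {z}" using opp 1 by auto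
      ultimately show ?thesis by simp
    next
      case 2
      have "wins False X (\<lambda>\<alpha>. W (\<alpha>(y := True, x := v)))"
      proof (rule wins_mono[OF W'])
        fix \<alpha> assume "W' \<alpha>"
        from opp.prems(5)[OF this, of v True] show "W (\<alpha>(y := True, x := v))"
          using opp.prems(4) by (simp add: fun_upd_twist del: fun_upd_apply)
      qed
      then show ?thesis using 2 opp.prems by (intro wins.hero[of y _ _ True]) auto
    next
      case 3
      have "wins False X (\<lambda>\<alpha>. W (\<alpha>(x := True, y := v)))"
        by (rule wins_mono[OF W']) (rule opp.prems(5))
      then show ?thesis using 3 opp.prems by (intro wins.hero[of x _ _ True]) (auto simp: insert_Diff_if simp del: fun_upd_apply)
    qed
  qed auto
qed

text \<open>The irrelevant variables are grouped into pairs. An odd number of them would let the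
  opponent change whose turn it is in the game on \<open>X\<close>.\<close>

lemma wins_dummies:
  assumes "wins b X W" "finite X" "finite D" "even (card D)" "X \<inter> D = {}"
    "\<And>\<alpha> \<beta>. (\<And>x. x \<notin> D \<Longrightarrow> \<alpha> x = \<beta> x) \<Longrightarrow> W \<alpha> \<Longrightarrow> W \<beta>"
  shows "wins b (X \<union> D) W"
  using assms(2-) assms(1)
proof (induction "card D" arbitrary: D rule: less_induct)
  case less
  show ?case
  proof (cases "D = {}")
    case True
    then show ?thesis using less by simp
  next
    case False
    then obtain x where x: "x \<in> D" by auto
    have "D \<noteq> {x}" using less.prems by auto
    with x obtain y where y: "y \<in> D" "y \<noteq> x" by auto
    define E where "E = D - {x, y}"
    have D: "D = insert x (insert y E)" "x \<notin> E" "y \<notin> E" using x y by (auto simp: E_def)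
    have cD: "card D = card E + 2" using D y less.prems by simp
    have "wins b (X \<union> E) W"
      using less.prems D cD by (intro less.hyps) auto
    then have "wins b (insert x (insert y (X \<union> E))) W"
    proof (rule wins_dummy_pair)
      fix \<alpha> u v assume "W \<alpha>"
      then show "W (\<alpha>(x := u, y := v))"
        by (rule less.prems(5)[rotated]) (use x y in auto)
    qed (use less.prems D y in auto)
    then show ?thesis by (simp add: D)
  qed
qed

text \<open>The hero keeps \<open>x\<close> and \<open>y\<close> equal (or opposite) by answering a move on one of them with a
  move on the other. The parity condition says that the hero makes the last move.\<close>

lemma wins_pairing:
  assumes "wins b X W'" "finite X" "x \<notin> X" "y \<notin> X" "x \<noteq> y" "b \<longleftrightarrow> odd (card X)"
    "\<And>\<alpha> u. W' \<alpha> \<Longrightarrow> W (\<alpha>(x := u, y := (u = c)))"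
  shows "wins b (insert x (insert y X)) W"
  using assms
proof (induction b X W' arbitrary: W rule: wins.induct)
  case (finished W' b)
  \<comment> \<open>With \<open>X\<close> exhausted, parity makes the opponent open the pair, so the
    hero can always choose the second value.\<close>
  then have "\<not> b" by simp
  have "wins True {y} (\<lambda>\<alpha>. W (\<alpha>(x := v)))" for v
    using finished(7)[OF finished(1), of _ v] finished(5)
    by (intro wins.hero[of y _ _ "v = c"])
      (auto intro!: wins.finished simp: fun_upd_twist simp del: fun_upd_apply)
  moreover have "wins True {x} (\<lambda>\<alpha>. W (\<alpha>(y := v)))" for v
    using finished(7)[OF finished(1), of _ "v = c"]
    by (intro wins.hero[of x _ _ "v = c"], simp, cases v; cases c)
      (auto intro!: wins.finished simp del: fun_upd_apply)
  ultimately have "wins False {x, y} W"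
    using finished(5) by (intro wins.opp) (auto simp: insert_Diff_if simp del: fun_upd_apply)
  then show ?case using \<open>\<not> b\<close> by simp
next
  case (hero z X W' v)
  have "wins False (insert x (insert y (X - {z}))) (\<lambda>\<alpha>. W (\<alpha>(z := v)))"
  proof (rule hero.IH)
    fix \<alpha> u assume "W' (\<alpha>(z := v))"
    from hero.prems(6)[OF this, of u] show "W (\<alpha>(x := u, y := (u = c), z := v))"
      using hero.hyps hero.prems by (subst fun_upd_rotate) (auto simp del: fun_upd_apply)
  qed (use hero in auto)
  moreover have "insert x (insert y (X - {z})) = insert x (insert y X) - {z}" using hero by auto
  ultimately show ?case using hero by (auto intro: wins.hero[of z _ _ v])
next
  case (opp X W')
  have W': "wins False X W'" by (rule wins.opp) (use opp.hyps in auto)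
  show ?case
  proof (rule wins.opp)
    fix z v assume z: "z \<in> insert x (insert y X)"
    then consider "z \<in> X" | "z = x" | "z = y" by auto
    then show "wins True (insert x (insert y X) - {z}) (\<lambda>\<alpha>. W (\<alpha>(z := v)))"
    proof cases
      case 1
      have "wins True (insert x (insert y (X - {z}))) (\<lambda>\<alpha>. W (\<alpha>(z := v)))"
      proof (rule opp.IH[OF 1, of v])
        have "card X \<noteq> 0" using opp.prems opp.hyps(1) by simp
        then show "True \<longleftrightarrow> odd (card (X - {z}))" using 1 opp.prems by simp
        fix \<alpha> u assume "W' (\<alpha>(z := v))"
        from opp.prems(6)[OF this, of u] show "W (\<alpha>(x := u, y := (u = c), z := v))"
          using 1 opp.prems by (subst fun_upd_rotate) (auto simp del: fun_upd_apply)
      qed (use opp 1 in auto)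
      moreover have "insert x (insert y (X - {z})) = insert x (insert y X) - {z}" using opp 1 by auto
      ultimately show ?thesis by simp
    next
      case 2
      have "wins False X (\<lambda>\<alpha>. W (\<alpha>(y := (v = c), x := v)))"
      proof (rule wins_mono[OF W'])
        fix \<alpha> assume "W' \<alpha>"
        from opp.prems(6)[OF this, of v] show "W (\<alpha>(y := (v = c), x := v))"
          using opp.prems(4) by (simp add: fun_upd_twist del: fun_upd_apply)
      qed
      then show ?thesis using 2 opp.prems by (intro wins.hero[of y _ _ "v = c"]) auto
    next
      case 3
      have "wins False X (\<lambda>\<alpha>. W (\<alpha>(x := (v = c), y := v)))"
      proof (rule wins_mono[OF W'])
        fix \<alpha> assume "W' \<alpha>"
        from opp.prems(6)[OF this, of "v = c"] show "W (\<alpha>(x := (v = c), y := v))"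
          by (cases v; cases c) (auto simp del: fun_upd_apply)
      qed
      then show ?thesis using 3 opp.prems
        by (intro wins.hero[of x _ _ "v = c"]) (auto simp: insert_Diff_if simp del: fun_upd_apply)
    qed
  qed auto
qed

lemma satisfies_iff: "satisfies \<alpha> \<phi> \<longleftrightarrow> (\<forall>C\<in>\<phi>. \<exists>l\<in>C. \<alpha> (fst l) = snd l)"
  by (simp add: satisfies_def case_prod_beta)

section \<open>Plays and strategies\<close>

text \<open>\<open>assignment_of\<close> gives unplayed variables the value False. Here they keep
  the value from \<open>\<alpha>\<close>, so that a condition on unfinished plays can be compared
  with the substituted \<open>W\<close> of \<open>wins\<close>.\<close>

definition override :: "move list \<Rightarrow> (nat \<Rightarrow> bool) \<Rightarrow> nat \<Rightarrow> bool" where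
  "override h \<alpha> x = (if x \<in> fst ` set h then assignment_of h x else \<alpha> x)"

lemma override_Nil [simp]: "override [] \<alpha> = \<alpha>"
  by (auto simp: override_def)

lemma override_self: "override h (assignment_of h) = assignment_of h"
  by (auto simp: override_def)

lemma override_snoc:
  "x \<notin> fst ` set h \<Longrightarrow> override (h @ [(x, v)]) \<alpha> = override h (\<alpha>(x := v))"
  by (rule ext) (force simp: override_def assignment_of_def)

lemma legal_play_snoc:
  "legal_play X (h @ [m]) \<longleftrightarrow> legal_play X h \<and> fst m \<in> X - fst ` set h"
  by (auto simp: legal_play_def)

lemma follows_snoc:
  "follows a p \<sigma> (h @ [m]) \<longleftrightarrow> follows a p \<sigma> h \<and> (mover a (length h) = p \<longrightarrow> m = \<sigma> h)"
  unfolding follows_def by (auto simp: nth_append less_Suc_eq)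

lemma mover_Suc: "mover a (Suc i) = opponent (mover a i)"
  by (cases a) (auto simp: mover_def)

text \<open>A derivation of \<open>wins\<close> is a strategy tree of the hero. Here
  \<open>p\<close> is the hero's opponent: \<open>\<sigma>\<close> selects the branch at the
  opponent's nodes, and \<open>h\<close> records the path walked so far.\<close>

lemma wins_play_against:
  assumes "wins b Y W" "legal_strategy X a p \<sigma>" "legal_play X h" "follows a p \<sigma> h"
    "Y = X - fst ` set h" "mover a (length h) = (if b then opponent p else p)"
    "\<And>\<alpha>. W \<alpha> \<Longrightarrow> Q (override h \<alpha>)"
  shows "\<exists>h'. complete_play X h' \<and> follows a p \<sigma> h' \<and> Q (assignment_of h')"
  using assms
proof (induction b Y W arbitrary: h rule: wins.induct)
  case (finished W b)
  have "complete_play X h" using finished by (auto simp: complete_play_def legal_play_def)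
  moreover have "Q (assignment_of h)" using finished(7)[OF finished(1)] override_self by metis
  ultimately show ?case using finished by blast
next
  case (hero x Y W v)
  show ?case
  proof (rule hero.IH[of "h @ [(x, v)]"])
    show "legal_play X (h @ [(x, v)])" using hero by (simp add: legal_play_snoc)
    have "opponent p \<noteq> p" by (cases p) auto
    then show "follows a p \<sigma> (h @ [(x, v)])" using hero by (simp add: follows_snoc)
    show "mover a (length (h @ [(x, v)])) = (if False then opponent p else p)"
      using hero by (cases p) (auto simp: mover_Suc)
    fix \<alpha> assume "W (\<alpha>(x := v))"
    then show "Q (override (h @ [(x, v)]) \<alpha>)" using hero by (simp add: override_snoc)
  qed (use hero in auto)
next
  case (opp Y W)
  obtain x v where xv: "\<sigma> h = (x, v)" by force
  have "\<not> complete_play X h" using opp by (auto simp: complete_play_def)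
  then have "fst (\<sigma> h) \<in> X - fst ` set h" using opp.prems by (auto simp: legal_strategy_def)
  then have x: "x \<in> Y" using xv opp.prems(4) by simp
  show ?case
  proof (rule opp.IH[OF x, of "h @ [(x, v)]" v])
    show "legal_play X (h @ [(x, v)])" using opp x by (simp add: legal_play_snoc)
    show "follows a p \<sigma> (h @ [(x, v)])" using opp xv by (simp add: follows_snoc)
    show "mover a (length (h @ [(x, v)])) = (if True then opponent p else p)"
      using opp by (auto simp: mover_Suc)
    fix \<alpha> assume "W (\<alpha>(x := v))"
    then show "Q (override (h @ [(x, v)]) \<alpha>)" using opp x by (simp add: override_snoc)
  qed (use opp in auto)
qed

lemma wins_not_F_has_winning_strategy:
  assumes "wins True X (\<lambda>\<alpha>. satisfies \<alpha> \<phi>)"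
  shows "\<not> F_has_winning_strategy \<phi> X PlayerT"
proof
  assume "F_has_winning_strategy \<phi> X PlayerT"
  then obtain \<sigma> where \<sigma>: "legal_strategy X PlayerT PlayerF \<sigma>"
    "\<And>h. complete_play X h \<Longrightarrow> follows PlayerT PlayerF \<sigma> h \<Longrightarrow> \<not> satisfies (assignment_of h) \<phi>"
    by (auto simp: F_has_winning_strategy_def)
  have "\<exists>h. complete_play X h \<and> follows PlayerT PlayerF \<sigma> h \<and> satisfies (assignment_of h) \<phi>"
    by (rule wins_play_against[OF assms \<sigma>(1), of "[]"])
      (auto simp: legal_play_def follows_def mover_def)
  then show False using \<sigma>(2) by blast
qed

text \<open>F always moves to a position that is still won. That \<open>pos\<close> holds after
  every play following \<open>\<sigma>\<close> is shown by appending one move at a time.\<close>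

lemma wins_F_has_winning_strategy:
  assumes "wins False X (\<lambda>\<alpha>. \<not> satisfies \<alpha> \<phi>)"
  shows "F_has_winning_strategy \<phi> X PlayerT"
proof -
  define pos where "pos h = wins (mover PlayerT (length h) = PlayerF) (X - fst ` set h)
    (\<lambda>\<alpha>. \<not> satisfies (override h \<alpha>) \<phi>)" for h
  \<comment> \<open>The last branch serves positions without a winning move: a legal strategy must
    name a free variable there too.\<close>
  define \<sigma> where "\<sigma> h = (if \<exists>m. fst m \<in> X - fst ` set h \<and> pos (h @ [m])
    then SOME m. fst m \<in> X - fst ` set h \<and> pos (h @ [m])
    else (SOME x. x \<in> X - fst ` set h, True))" for h
  have \<sigma>_good: "fst (\<sigma> h) \<in> X - fst ` set h \<and> pos (h @ [\<sigma> h])"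
    if "\<exists>m. fst m \<in> X - fst ` set h \<and> pos (h @ [m])" for h
    using someI_ex[OF that] that by (simp add: \<sigma>_def)
  have legal: "legal_strategy X PlayerT PlayerF \<sigma>"
    unfolding legal_strategy_def
  proof (intro allI impI)
    fix h assume h: "legal_play X h \<and> \<not> complete_play X h \<and> mover PlayerT (length h) = PlayerF"
    then have "\<exists>x. x \<in> X - fst ` set h" by (auto simp: complete_play_def legal_play_def)
    then have *: "(SOME x. x \<in> X - fst ` set h) \<in> X - fst ` set h" by (rule someI_ex)
    show "fst (\<sigma> h) \<in> X - fst ` set h"
    proof (cases "\<exists>m. fst m \<in> X - fst ` set h \<and> pos (h @ [m])")
      case True
      then show ?thesis using \<sigma>_good by blast
    next
      case False
      then have "\<sigma> h = (SOME x. x \<in> X - fst ` set h, True)" unfolding \<sigma>_def by (rule if_not_P)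
      then show ?thesis using * by simp
    qed
  qed
  have step: "pos (h @ [(x, v)])"
    if "wins b (X - fst ` set h - {x}) (\<lambda>\<alpha>. \<not> satisfies (override h (\<alpha>(x := v))) \<phi>)"
      "x \<in> X - fst ` set h" "b \<longleftrightarrow> mover PlayerT (length h) = PlayerT" for b h x v
  proof -
    have "X - fst ` set (h @ [(x, v)]) = X - fst ` set h - {x}" by auto
    moreover have "b \<longleftrightarrow> mover PlayerT (length (h @ [(x, v)])) = PlayerF"
      using that(3) by (cases "mover PlayerT (length h)") (auto simp: mover_Suc)
    ultimately show ?thesis using that(1,2) unfolding pos_def by (simp add: override_snoc)
  qed
  have pos: "pos h" if "legal_play X h" "follows PlayerT PlayerF \<sigma> h" for h
    using that
  proof (induction h rule: rev_induct)
    case Nil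
    then show ?case using assms by (simp add: pos_def mover_def)
  next
    case (snoc m h)
    then have IH: "pos h" and m: "fst m \<in> X - fst ` set h"
      and \<sigma>m: "mover PlayerT (length h) = PlayerF \<Longrightarrow> m = \<sigma> h"
      by (auto simp: legal_play_snoc follows_snoc)
    obtain x v where xv: "m = (x, v)" by force
    show ?case
    proof (cases "mover PlayerT (length h)")
      case PlayerF
      from IH[unfolded pos_def] PlayerF have "wins True (X - fst ` set h) (\<lambda>\<alpha>. \<not> satisfies (override h \<alpha>) \<phi>)"
        by simp
      then obtain x' v' where x': "x' \<in> X - fst ` set h"
        "wins False (X - fst ` set h - {x'}) (\<lambda>\<alpha>. \<not> satisfies (override h (\<alpha>(x' := v'))) \<phi>)"
        using wins_True_D m by blast
      have "pos (h @ [(x', v')])" by (rule step[OF x'(2,1)]) (use PlayerF in auto)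
      then show ?thesis using \<sigma>_good[of h] \<sigma>m[OF PlayerF] x'(1) by (metis fst_conv)
    next
      case PlayerT
      from IH[unfolded pos_def] PlayerT have "wins False (X - fst ` set h) (\<lambda>\<alpha>. \<not> satisfies (override h \<alpha>) \<phi>)"
        by simp
      from wins_False_D[OF this, of x v] show ?thesis
        using m xv PlayerT step[of True h x v] by simp
    qed
  qed
  have "\<not> satisfies (assignment_of h) \<phi>"
    if "complete_play X h" "follows PlayerT PlayerF \<sigma> h" for h
  proof -
    have "pos h" using that pos by (simp add: complete_play_def)
    moreover have "X - fst ` set h = {}" using that by (simp add: complete_play_def)
    ultimately have "\<not> satisfies (override h (assignment_of h)) \<phi>"
      unfolding pos_def by (metis (no_types, lifting) wins_empty)
    then show ?thesis by (simp add: override_self)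
  qed
  then show ?thesis using legal unfolding F_has_winning_strategy_def by blast
qed

section \<open>The lower bound\<close>

fun neg :: "literal \<Rightarrow> literal" where
  "neg (x, v) = (x, \<not> v)"

lemma neg_neg [simp]: "neg (neg l) = l"
  by (cases l) simp

lemma fst_neg [simp]: "fst (neg l) = fst l"
  by (cases l) simp

lemma neg_neq [simp]: "neg l \<noteq> l"
  by (cases l) simp

definition restrict :: "literal \<Rightarrow> cnf \<Rightarrow> cnf" where
  "restrict l \<phi> = (\<lambda>C. C - {neg l}) ` {C \<in> \<phi>. l \<notin> C}"

lemma satisfies_restrict:
  assumes "satisfies \<alpha> (restrict (x, v) \<phi>)"
  shows "satisfies (\<alpha>(x := v)) \<phi>"
  unfolding satisfies_iff
proof
  fix C assume C: "C \<in> \<phi>"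
  show "\<exists>l\<in>C. (\<alpha>(x := v)) (fst l) = snd l"
  proof (cases "(x, v) \<in> C")
    case True
    then show ?thesis by (intro bexI[of _ "(x, v)"]) auto
  next
    case False
    with C have "C - {(x, \<not> v)} \<in> restrict (x, v) \<phi>" by (auto simp: restrict_def)
    with assms obtain l where l: "l \<in> C" "l \<noteq> (x, \<not> v)" "\<alpha> (fst l) = snd l"
      unfolding satisfies_iff by blast
    with False have "fst l \<noteq> x" by (cases l) auto
    with l show ?thesis by (intro bexI[of _ l]) auto
  qed
qed

text \<open>The dropped clauses are those that \<open>l = m\<close> makes tautological; deleting the two variables from
  the others assumes the worst for T.\<close>

definition identify :: "literal \<Rightarrow> literal \<Rightarrow> cnf \<Rightarrow> cnf" where
  "identify l m \<phi> = (\<lambda>C. C - {l, neg l, m, neg m}) `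
    {C \<in> \<phi>. \<not> (l \<in> C \<and> neg m \<in> C) \<and> \<not> (neg l \<in> C \<and> m \<in> C)}"

text \<open>\<open>u = c\<close> is a biconditional, so \<open>(x, True)\<close> and
  \<open>(y, c)\<close> receive the same truth value. Hence a dropped clause is true for either
  \<open>u\<close>, and every other clause is satisfied by what is left of it.\<close>

lemma satisfies_identify:
  assumes "satisfies \<alpha> (identify (x, True) (y, c) \<phi>)" "x \<noteq> y"
  shows "satisfies (\<alpha>(x := u, y := (u = c))) \<phi>"
  unfolding satisfies_iff
proof
  fix C assume C: "C \<in> \<phi>"
  let ?\<beta> = "\<alpha>(x := u, y := (u = c))"
  consider "(x, u) \<in> C" | "(y, u = c) \<in> C"
    | "\<not> ((x, True) \<in> C \<and> (y, \<not> c) \<in> C \<or> (x, False) \<in> C \<and> (y, c) \<in> C)"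
    by (cases u; cases c) auto
  then show "\<exists>l\<in>C. ?\<beta> (fst l) = snd l"
  proof cases
    case 1
    then show ?thesis using assms(2) by (intro bexI[of _ "(x, u)"]) auto
  next
    case 2
    then show ?thesis by (intro bexI[of _ "(y, u = c)"]) auto
  next
    case 3
    with C have "C - {(x, True), (x, False), (y, c), (y, \<not> c)} \<in> identify (x, True) (y, c) \<phi>"
      by (auto simp: identify_def)
    with assms(1) obtain l where l: "l \<in> C - {(x, True), (x, False), (y, c), (y, \<not> c)}"
      "\<alpha> (fst l) = snd l"
      unfolding satisfies_iff by blast
    obtain a b where ab: "l = (a, b)" by force
    have "a \<noteq> x" "a \<noteq> y" using l(1) ab by (cases b; cases c; auto)+
    then show ?thesis using l ab by (intro bexI[of _ l]) auto
  qed
qed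

text \<open>Injectivity of \<^const>\<open>fst\<close> excludes tautological clauses.\<close>

definition proper :: "nat set \<Rightarrow> cnf \<Rightarrow> bool" where
  "proper X \<phi> \<longleftrightarrow> finite \<phi> \<and> (\<forall>C\<in>\<phi>. finite C \<and> inj_on fst C \<and> fst ` C \<subseteq> X)"

lemma proper_neg: "proper X \<phi> \<Longrightarrow> C \<in> \<phi> \<Longrightarrow> l \<in> C \<Longrightarrow> neg l \<notin> C"
  unfolding proper_def by (metis inj_onD fst_neg neg_neq)

lemma proper_image_Diff:
  assumes "proper X \<phi>" "\<psi> \<subseteq> \<phi>" "\<And>C l. C \<in> \<psi> \<Longrightarrow> l \<in> C - L \<Longrightarrow> fst l \<notin> Y"
  shows "proper (X - Y) ((\<lambda>C. C - L) ` \<psi>)"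
  unfolding proper_def
proof
  show "finite ((\<lambda>C. C - L) ` \<psi>)" using assms(1,2) by (auto simp: proper_def dest: finite_subset)
  show "\<forall>D\<in>(\<lambda>C. C - L) ` \<psi>. finite D \<and> inj_on fst D \<and> fst ` D \<subseteq> X - Y"
  proof
    fix D assume "D \<in> (\<lambda>C. C - L) ` \<psi>"
    then obtain C where C: "C \<in> \<psi>" "D = C - L" by auto
    then have "finite C" "inj_on fst C" "fst ` C \<subseteq> X" using assms(1,2) by (auto simp: proper_def)
    moreover have "fst ` D \<inter> Y = {}" using assms(3) C by blast
    moreover have "D \<subseteq> C" using C by blast
    ultimately show "finite D \<and> inj_on fst D \<and> fst ` D \<subseteq> X - Y"
      by (meson Diff_subset Int_emptyI finite_subset image_mono inj_on_subset subset_trans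
          Diff_disjoint disjoint_iff Diff_iff subset_iff)
  qed
qed

lemma fst_eq_iff_neg: "fst k = fst l \<longleftrightarrow> k = l \<or> k = neg l"
  by (cases k; cases l) auto

lemma proper_restrict:
  assumes "proper X \<phi>"
  shows "proper (X - {fst l}) (restrict l \<phi>)"
  unfolding restrict_def by (rule proper_image_Diff[OF assms]) (auto simp: fst_eq_iff_neg)

lemma proper_identify:
  assumes "proper X \<phi>"
  shows "proper (X - {fst l, fst m}) (identify l m \<phi>)"
  unfolding identify_def by (rule proper_image_Diff[OF assms]) (auto simp: fst_eq_iff_neg)

section \<open>Clause weights and their change under moves and identifications\<close>

definition weight :: "clause \<Rightarrow> real" where
  "weight C = (2 / 3) ^ card C"

lemma weight_pos: "weight C > 0"
  by (simp add: weight_def)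

lemma weight_remove:
  assumes "finite C" "l \<in> C"
  shows "weight (C - {l}) = 3 / 2 * weight C"
proof -
  have "card C = Suc (card (C - {l}))" using assms by (simp only: card_Suc_Diff1)
  then have "weight C = 2 / 3 * weight (C - {l})" unfolding weight_def by (simp only: power_Suc)
  then show ?thesis by simp
qed

definition potential :: "cnf \<Rightarrow> real" where
  "potential \<phi> = sum weight \<phi>"

text \<open>The ratio by which the weight of \<open>C\<close> changes when \<open>l\<close> is made
  true; a satisfied clause disappears.\<close>

definition factor :: "literal \<Rightarrow> clause \<Rightarrow> real" where
  "factor l C = (if l \<in> C then 0 else if neg l \<in> C then 3 / 2 else 1)"

text \<open>Only an inequality, since different clauses may coincide once \<open>neg l\<close> is
  deleted. \<open>h\<close> is general so that a second move can be charged to the original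
  clauses.\<close>

lemma sum_restrict_le:
  fixes h :: "clause \<Rightarrow> real"
  assumes "proper X \<phi>" "\<And>C. h C \<ge> 0"
  shows "sum h (restrict l \<phi>) \<le> (\<Sum>C\<in>\<phi>. if l \<in> C then 0 else h (C - {neg l}))"
proof -
  have fin: "finite \<phi>" using assms(1) by (simp add: proper_def)
  have "sum h (restrict l \<phi>) \<le> sum (h \<circ> (\<lambda>C. C - {neg l})) {C \<in> \<phi>. l \<notin> C}"
    unfolding restrict_def by (rule sum_image_le) (use fin assms(2) in auto)
  also have "\<dots> = (\<Sum>C\<in>\<phi>. if l \<in> C then 0 else h (C - {neg l}))"
    by (rule sum.mono_neutral_cong_left) (use fin in auto)
  finally show ?thesis .
qed

lemma weight_factor:
  "finite C \<Longrightarrow> (if l \<in> C then 0 else weight (C - {neg l})) = factor l C * weight C"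
  by (auto simp: factor_def weight_remove)

lemma potential_restrict_le:
  assumes "proper X \<phi>"
  shows "potential (restrict l \<phi>) \<le> (\<Sum>C\<in>\<phi>. factor l C * weight C)"
proof -
  have "potential (restrict l \<phi>) \<le> (\<Sum>C\<in>\<phi>. if l \<in> C then 0 else weight (C - {neg l}))"
    unfolding potential_def by (rule sum_restrict_le[OF assms]) (simp add: weight_pos less_imp_le)
  also have "\<dots> = (\<Sum>C\<in>\<phi>. factor l C * weight C)"
    using assms by (intro sum.cong refl weight_factor) (auto simp: proper_def)
  finally show ?thesis .
qed

text \<open>The factors multiply because deleting \<open>neg l\<close> does not affect whether a
  clause contains \<open>m\<close> or \<open>neg m\<close>.\<close>

lemma potential_restrict2_le:
  assumes "proper X \<phi>" "fst l \<noteq> fst m"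
  shows "potential (restrict m (restrict l \<phi>)) \<le> (\<Sum>C\<in>\<phi>. factor l C * factor m C * weight C)"
proof -
  have "potential (restrict m (restrict l \<phi>)) \<le> (\<Sum>C\<in>restrict l \<phi>. factor m C * weight C)"
    using proper_restrict[OF assms(1)] by (rule potential_restrict_le)
  also have "\<dots> \<le> (\<Sum>C\<in>\<phi>. if l \<in> C then 0 else factor m (C - {neg l}) * weight (C - {neg l}))"
    by (rule sum_restrict_le[OF assms(1)]) (simp add: weight_pos less_imp_le factor_def)
  also have "\<dots> = (\<Sum>C\<in>\<phi>. factor l C * factor m C * weight C)"
  proof (rule sum.cong[OF refl])
    fix C assume "C \<in> \<phi>"
    then have "finite C" using assms(1) by (simp add: proper_def)
    have "m \<noteq> neg l" "neg m \<noteq> neg l" using assms(2) fst_neg by metis+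
    then have "factor m (C - {neg l}) = factor m C" by (auto simp: factor_def)
    then show "(if l \<in> C then 0 else factor m (C - {neg l}) * weight (C - {neg l})) =
        factor l C * factor m C * weight C"
      using weight_factor[OF \<open>finite C\<close>, of l] by (auto split: if_splits)
  qed
  finally show ?thesis .
qed

text \<open>The counterpart of \<open>factor\<close> for \<open>identify\<close>: each of the two
  variables that is deleted from a surviving clause costs 3/2.\<close>

definition pair_factor :: "literal \<Rightarrow> literal \<Rightarrow> clause \<Rightarrow> real" where
  "pair_factor l m C = (if l \<in> C \<and> neg m \<in> C \<or> neg l \<in> C \<and> m \<in> C then 0
     else (if l \<in> C \<or> neg l \<in> C then 3 / 2 else 1) * (if m \<in> C \<or> neg m \<in> C then 3 / 2 else 1))"

lemma potential_identify_le:
  assumes "proper X \<phi>" "fst l \<noteq> fst m"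
  shows "potential (identify l m \<phi>) \<le> (\<Sum>C\<in>\<phi>. pair_factor l m C * weight C)"
proof -
  let ?S = "{C \<in> \<phi>. \<not> (l \<in> C \<and> neg m \<in> C) \<and> \<not> (neg l \<in> C \<and> m \<in> C)}"
  have fin: "finite \<phi>" using assms(1) by (simp add: proper_def)
  have w: "weight (C - {l, neg l, m, neg m}) = pair_factor l m C * weight C" if "C \<in> ?S" for C
  proof -
    have C: "finite C" using assms(1) that by (simp add: proper_def)
    have l: "weight (D - {l, neg l}) = (if l \<in> D \<or> neg l \<in> D then 3 / 2 else 1) * weight D"
      if "finite D" "l \<in> D \<Longrightarrow> neg l \<notin> D" for D l
    proof -
      have "D - {l, neg l} = (if l \<in> D then D - {l} else if neg l \<in> D then D - {neg l} else D)"
        using that(2) by auto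
      then show ?thesis using that(1) by (auto simp: weight_remove)
    qed
    have ne: "l \<noteq> m" "neg l \<noteq> m" "l \<noteq> neg m" "neg l \<noteq> neg m" using assms(2) fst_neg by metis+
    have "C - {l, neg l, m, neg m} = C - {l, neg l} - {m, neg m}" by auto
    also have "weight \<dots> = (if m \<in> C \<or> neg m \<in> C then 3 / 2 else 1) * weight (C - {l, neg l})"
      using ne C proper_neg[OF assms(1), of C m] that by (subst l) auto
    also have "weight (C - {l, neg l}) = (if l \<in> C \<or> neg l \<in> C then 3 / 2 else 1) * weight C"
      using C proper_neg[OF assms(1), of C l] that by (subst l) auto
    finally show ?thesis using that by (auto simp: pair_factor_def)
  qed
  have "potential (identify l m \<phi>) \<le> sum (weight \<circ> (\<lambda>C. C - {l, neg l, m, neg m})) ?S"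
    unfolding potential_def identify_def
    by (rule sum_image_le) (use fin weight_pos in \<open>auto simp: less_imp_le\<close>)
  also have "\<dots> = (\<Sum>C\<in>\<phi>. pair_factor l m C * weight C)"
    using fin w by (intro sum.mono_neutral_cong_left) (auto simp: pair_factor_def)
  finally show ?thesis .
qed

text \<open>The guaranteed drop of the potential when \<open>l\<close> is made true; merging clauses
  can only increase the drop.\<close>

definition gain :: "cnf \<Rightarrow> literal \<Rightarrow> real" where
  "gain \<phi> l = (\<Sum>C\<in>\<phi>. (1 - factor l C) * weight C)"

text \<open>T makes a literal \<open>l\<close> of maximal gain true and F answers with \<open>m\<close>. This could raise the
  potential only if most of the weight on the two variables sat in clauses containing both \<open>l\<close> and \<open>m\<close>
  or both of their negations, and then identifying \<open>l\<close> with \<open>neg m\<close> would not raise it. The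
  inequality \<open>pw\<close>, checked clause by clause, is the resulting linear combination.\<close>

lemma potential_after_round:
  assumes "proper X \<phi>" "fst l \<noteq> fst m"
    and max: "gain \<phi> (neg l) \<le> gain \<phi> l" "gain \<phi> m \<le> gain \<phi> l" "gain \<phi> (neg m) \<le> gain \<phi> l"
    and no_pair: "potential \<phi> \<le> (\<Sum>C\<in>\<phi>. pair_factor l (neg m) C * weight C)"
  shows "potential (restrict m (restrict l \<phi>)) \<le> potential \<phi>"
proof -
  let ?g = "\<lambda>l C. 1 - factor l C"
  \<comment> \<open>Summed with weights, the three terms are at most 0: \<open>neg m\<close> gains
    no more than \<open>l\<close>, the average of the four gains is no more than that of
    \<open>l\<close>, and \<open>no_pair\<close> holds. The coefficients 1/2, 1/2, 1/8 give equality
    for clauses whose literals on the two variables are \<open>l\<close> alone, \<open>neg l\<close>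
    alone, \<open>neg m\<close> alone, both \<open>l\<close> and \<open>m\<close>, or both
    negations.\<close>
  have pw: "factor l C * factor m C - 1 \<le> (?g (neg m) C - ?g l C) / 2
      + ((?g l C + ?g (neg l) C + ?g m C + ?g (neg m) C) / 4 - ?g l C) / 2
      + (1 - pair_factor l (neg m) C) / 8" if "C \<in> \<phi>" for C
    using proper_neg[OF assms(1) that, of l] proper_neg[OF assms(1) that, of m]
    by (auto simp: factor_def pair_factor_def)
  have "(\<Sum>C\<in>\<phi>. factor l C * factor m C * weight C) - potential \<phi>
      = (\<Sum>C\<in>\<phi>. (factor l C * factor m C - 1) * weight C)"
    by (simp add: potential_def left_diff_distrib sum_subtractf)
  also have "\<dots> \<le> (\<Sum>C\<in>\<phi>. ((?g (neg m) C - ?g l C) / 2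
      + ((?g l C + ?g (neg l) C + ?g m C + ?g (neg m) C) / 4 - ?g l C) / 2
      + (1 - pair_factor l (neg m) C) / 8) * weight C)"
    by (intro sum_mono mult_right_mono pw) (auto simp: weight_pos less_imp_le)
  also have "\<dots> = (gain \<phi> (neg m) - gain \<phi> l) / 2
      + ((gain \<phi> l + gain \<phi> (neg l) + gain \<phi> m + gain \<phi> (neg m)) / 4 - gain \<phi> l) / 2
      + (potential \<phi> - (\<Sum>C\<in>\<phi>. pair_factor l (neg m) C * weight C)) / 8"
    unfolding gain_def potential_def
    by (simp only: sum.distrib sum_subtractf sum_divide_distrib distrib_right left_diff_distrib
        add_divide_distrib diff_divide_distrib times_divide_eq_left mult_1)
  also have "\<dots> \<le> 0"
  proof -
    have "(g' - g) / 2 + ((g + a + b + g') / 4 - g) / 2 + (p - q) / 8 \<le> 0"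
      if "a \<le> g" "b \<le> g" "g' \<le> g" "p \<le> q" for a b g g' p q :: real
      using that by (simp add: field_simps)
    from this[OF max no_pair] show ?thesis .
  qed
  finally show ?thesis using potential_restrict2_le[OF assms(1,2)] by linarith
qed

text \<open>A clause on the variable of \<open>l\<close> loses its whole weight under one value and
  gains half of it under the other. So a literal of greatest gain has nonnegative gain.\<close>

lemma gain_sum_nonneg:
  assumes "proper X \<phi>"
  shows "gain \<phi> l + gain \<phi> (neg l) \<ge> 0"
proof -
  have "gain \<phi> l + gain \<phi> (neg l) = (\<Sum>C\<in>\<phi>. (1 - factor l C + (1 - factor (neg l) C)) * weight C)"
    unfolding gain_def by (simp only: sum.distrib distrib_right)
  also have "\<dots> \<ge> 0"
    using proper_neg[OF assms, of _ l]
    by (intro sum_nonneg mult_nonneg_nonneg) (auto simp: factor_def weight_pos less_imp_le)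
  finally show ?thesis .
qed

text \<open>The only clause without variables is the empty one, and it alone would have weight
  1.\<close>

lemma satisfies_of_no_vars:
  assumes "proper {} \<phi>" "potential \<phi> < 1"
  shows "satisfies \<alpha> \<phi>"
proof -
  have "\<phi> \<subseteq> {{}}" using assms(1) by (auto simp: proper_def)
  moreover have "\<phi> \<noteq> {{}}" using assms(2) by (auto simp: potential_def weight_def)
  ultimately have "\<phi> = {}" by blast
  then show ?thesis by (simp add: satisfies_def)
qed

text \<open>Setting a pair aside and playing a round both remove two variables, so T stays on move
  with an odd number of them until a single one is left.\<close>

lemma potential_less_1_wins:
  assumes "finite X" "odd (card X)" "proper X \<phi>" "potential \<phi> < 1"
  shows "wins True X (\<lambda>\<alpha>. satisfies \<alpha> \<phi>)"
  using assms
proof (induction "card X" arbitrary: X \<phi> rule: less_induct)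
  case less
  note fin = less.prems(1) and proper = less.prems(3)
  show ?case
  proof (cases "\<exists>x\<in>X. \<exists>y\<in>X. \<exists>c. x \<noteq> y \<and> potential (identify (x, True) (y, c) \<phi>) \<le> potential \<phi>")
    case True
    then obtain x y c where xy: "x \<in> X" "y \<in> X" "x \<noteq> y"
      "potential (identify (x, True) (y, c) \<phi>) \<le> potential \<phi>" by blast
    have cX: "card X = card (X - {x, y}) + 2"
      using xy fin by (simp add: card_Diff_subset) (metis card_le_Suc0_iff_eq add_2_eq_Suc' le_add_diff_inverse2 not_less_eq_eq numeral_2_eq_2)
    have odd': "odd (card (X - {x, y}))" using cX less.prems(2) by simp
    have "wins True (X - {x, y}) (\<lambda>\<alpha>. satisfies \<alpha> (identify (x, True) (y, c) \<phi>))"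
      using cX odd' fin xy(4) less.prems(4) proper_identify[OF proper, of "(x, True)" "(y, c)"]
      by (intro less.hyps) auto
    then have "wins True (insert x (insert y (X - {x, y}))) (\<lambda>\<alpha>. satisfies \<alpha> \<phi>)"
      by (rule wins_pairing[where c = c])
        (use fin odd' xy(3) satisfies_identify in \<open>auto simp del: fun_upd_apply\<close>)
    moreover have "insert x (insert y (X - {x, y})) = X" using xy by auto
    ultimately show ?thesis by simp
  next
    case no_pair: False
    have "X \<noteq> {}" using less.prems(2) by auto
    then have L: "finite (gain \<phi> ` (X \<times> UNIV))" "gain \<phi> ` (X \<times> UNIV) \<noteq> {}" using fin by auto
    obtain l where l: "l \<in> X \<times> UNIV" and "gain \<phi> l = Max (gain \<phi> ` (X \<times> UNIV))"
      using Max_in[OF L] by auto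
    then have max: "gain \<phi> m \<le> gain \<phi> l" if "fst m \<in> X" for m
      using Max_ge[OF L(1), of "gain \<phi> m"] that by (cases m) auto
    obtain x v where xv: "l = (x, v)" by force
    have x: "x \<in> X" using l xv by simp
    show ?thesis
    proof (rule wins.hero[OF x, of _ v], cases "X = {x}")
      case True
      \<comment> \<open>No reply of F follows the last move, so a nonnegative gain is
        enough.\<close>
      have "potential (restrict l \<phi>) \<le> potential \<phi> - gain \<phi> l"
        using potential_restrict_le[OF proper, of l]
        by (simp add: gain_def potential_def left_diff_distrib sum_subtractf)
      moreover have "gain \<phi> l \<ge> 0" using gain_sum_nonneg[OF proper, of l] max[of "neg l"] x xv by simp
      ultimately have "satisfies \<alpha> (restrict l \<phi>)" for \<alpha>
        using less.prems(4) proper_restrict[OF proper, of l] True xv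
        by (intro satisfies_of_no_vars) auto
      then show "wins False (X - {x}) (\<lambda>\<alpha>. satisfies (\<alpha>(x := v)) \<phi>)"
        using True xv satisfies_restrict by (auto intro!: wins.finished simp del: fun_upd_apply)
    next
      case False
      show "wins False (X - {x}) (\<lambda>\<alpha>. satisfies (\<alpha>(x := v)) \<phi>)"
      proof (rule wins.opp)
        show "X - {x} \<noteq> {}" using False x by auto
        fix y u assume y: "y \<in> X - {x}"
        let ?\<psi> = "restrict (y, u) (restrict l \<phi>)"
        have pair: "potential \<phi> \<le> (\<Sum>C\<in>\<phi>. pair_factor l (neg (y, u)) C * weight C)"
        proof -
          have "potential \<phi> < potential (identify (x, True) (y, c) \<phi>)" for c
          proof (rule ccontr)
            assume "\<not> ?thesis"
            then have "potential (identify (x, True) (y, c) \<phi>) \<le> potential \<phi>" by simp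
            moreover have "x \<noteq> y" "y \<in> X" using y by auto
            ultimately have "\<exists>x\<in>X. \<exists>y\<in>X. \<exists>c. x \<noteq> y \<and>
                potential (identify (x, True) (y, c) \<phi>) \<le> potential \<phi>"
              by (intro bexI[OF _ x] bexI[of _ y] exI[of _ c] conjI)
            then show False by (rule notE[OF no_pair])
          qed
          \<comment> \<open>Negating both literals does not change an identification, so identifying
            \<open>l = (x, v)\<close> with \<open>neg (y, u)\<close> amounts to identifying
            \<open>(x, True)\<close> with \<open>(y, u \<noteq> v)\<close>.\<close>
          then have "potential \<phi> < potential (identify (x, True) (y, u \<noteq> v) \<phi>)" .
          also have "\<dots> \<le> (\<Sum>C\<in>\<phi>. pair_factor (x, True) (y, u \<noteq> v) C * weight C)"
            by (rule potential_identify_le[OF proper]) (use y in auto)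
          also have "pair_factor (x, True) (y, u \<noteq> v) = pair_factor l (neg (y, u))"
            unfolding xv by (cases u; cases v) (auto simp: pair_factor_def fun_eq_iff)
          finally show ?thesis by simp
        qed
        have "potential ?\<psi> \<le> potential \<phi>"
          using x y xv by (intro potential_after_round[OF proper _ _ _ _ pair] max) auto
        moreover have "proper (X - {x} - {y}) ?\<psi>"
          using proper_restrict[OF proper_restrict[OF proper, of l], of "(y, u)"] xv by simp
        moreover have cX: "card X = card (X - {x} - {y}) + 2"
          using x y fin card_Suc_Diff1[of X x] card_Suc_Diff1[of "X - {x}" y] by simp
        moreover from cX have "odd (card (X - {x} - {y}))" using less.prems(2) by simp
        ultimately have "wins True (X - {x} - {y}) (\<lambda>\<alpha>. satisfies \<alpha> ?\<psi>)"
          using fin less.prems(4) by (intro less.hyps) auto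
        then show "wins True (X - {x} - {y}) (\<lambda>\<alpha>. satisfies (\<alpha>(y := u, x := v)) \<phi>)"
          by (rule wins_mono) (use satisfies_restrict xv in \<open>auto simp del: fun_upd_apply\<close>)
      qed
    qed
  qed
qed

lemma F_winning_card_ge:
  assumes "game_instance \<phi> X" "k_uniform k \<phi>" "X \<noteq> {}" "mover PlayerT (card X - 1) = PlayerT"
    "F_has_winning_strategy \<phi> X PlayerT"
  shows "(3 / 2) ^ k \<le> real (card \<phi>)"
proof (rule ccontr)
  assume "\<not> (3 / 2) ^ k \<le> real (card \<phi>)"
  then have less: "real (card \<phi>) < (3 / 2) ^ k" by simp
  have fin: "finite X" and vars: "cnf_vars \<phi> \<subseteq> X" using assms(1) by (auto simp: game_instance_def)
  have "\<phi> \<subseteq> Pow (X \<times> UNIV)"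
    using vars by (force simp: cnf_vars_def)
  then have "finite \<phi>" using fin by (meson finite_Pow_iff finite_SigmaI finite finite_subset)
  then have "proper X \<phi>"
    using assms(2) vars by (auto simp: proper_def k_uniform_def cnf_vars_def intro: eq_card_imp_inj_on)
  moreover have "potential \<phi> < 1"
  proof -
    have "potential \<phi> = real (card \<phi>) * (2 / 3) ^ k"
      using assms(2) by (simp add: potential_def weight_def k_uniform_def)
    also have "\<dots> < (3 / 2) ^ k * (2 / 3) ^ k" using less by (intro mult_strict_right_mono) auto
    also have "\<dots> = 1" by (simp flip: power_mult_distrib)
    finally show ?thesis .
  qed
  moreover have "odd (card X)"
    using assms(3,4) fin by (auto simp: mover_def split: if_splits)
  ultimately show False
    using potential_less_1_wins fin wins_not_F_has_winning_strategy assms(5) by blast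
qed

section \<open>The upper bound\<close>

text \<open>F wins \<open>(x \<or> \<phi>) \<and> (\<not> x \<or> y \<or> \<psi>)\<close>, with \<open>V\<close> and \<open>U\<close> the failure of \<open>\<phi>\<close> and \<open>\<psi>\<close>:
  F answers in \<open>A\<close> as long as T plays there. Once T plays elsewhere, F answers \<open>x := True\<close>
  by \<open>y := False\<close> and any other move by \<open>x := False\<close>, after which only one of the two games
  matters. The variable \<open>z\<close> makes the number of irrelevant ones even.\<close>

lemma wins_combine:
  assumes "wins b A V" "finite A" "b \<longleftrightarrow> even (card A)"
    and "wins False B U" "finite B" "odd (card B)" "A \<inter> B = {}"
    and "distinct [x, y, z]" "{x, y, z} \<inter> (A \<union> B) = {}"
    and "\<And>\<alpha> \<beta>. (\<And>a. a \<notin> B \<union> {x, y, z} \<Longrightarrow> \<alpha> a = \<beta> a) \<Longrightarrow> V \<alpha> \<Longrightarrow> V \<beta>"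
    and "\<And>\<alpha> \<beta>. (\<And>a. a \<in> B \<Longrightarrow> \<alpha> a = \<beta> a) \<Longrightarrow> U \<alpha> \<Longrightarrow> U \<beta>"
    and "\<And>\<alpha>. V \<alpha> \<Longrightarrow> \<not> \<alpha> x \<Longrightarrow> W \<alpha>"
    and "\<And>\<alpha>. U \<alpha> \<Longrightarrow> \<alpha> x \<Longrightarrow> \<not> \<alpha> y \<Longrightarrow> W \<alpha>"
  shows "wins b (A \<union> (B \<union> {x, y, z})) W"
  using assms
proof (induction b A V arbitrary: W rule: wins.induct)
  case (finished V b)
  \<comment> \<open>The game on \<open>A\<close> is over and \<open>V\<close> is certain. By parity
    F is to move, and \<open>x := False\<close> settles the game.\<close>
  have "W (\<alpha>(x := False))" for \<alpha> using finished(12)[OF finished(1)] by simp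
  then have "wins True ({} \<union> (B \<union> {x, y, z})) W"
    by (intro wins.hero[of x _ _ False] wins_always) (use finished.prems(1,2,4-8) in auto)
  then show ?case using finished.prems(1,2,4-8) by simp
next
  case (hero a A V v)
  have V: "V (\<beta>(a := v))"
    if "\<And>c. c \<notin> B \<union> {x, y, z} \<Longrightarrow> \<alpha> c = \<beta> c" "V (\<alpha>(a := v))" for \<alpha> \<beta>
    by (rule hero.prems(9)[OF _ that(2)]) (use that(1) in auto)
  have U: "U (\<alpha>(a := v))" if "U \<alpha>" for \<alpha>
    by (rule hero.prems(10)[OF _ that]) (use hero.prems(1,2,4-8) hero.hyps in auto)
  have "wins False ((A - {a}) \<union> (B \<union> {x, y, z})) (\<lambda>\<alpha>. W (\<alpha>(a := v)))"
  proof (rule hero.IH[OF _ _ hero.prems(3-5) _ hero.prems(7) _ V hero.prems(10)])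
    show "False \<longleftrightarrow> even (card (A - {a}))" using hero.prems(1,2) hero.hyps(1)
      by (metis card_Suc_Diff1 even_Suc)
    show "W (\<alpha>(a := v))" if "V (\<alpha>(a := v))" "\<not> \<alpha> x" for \<alpha>
      by (rule hero.prems(11)[OF that(1)]) (use that(2) hero.prems(8) hero.hyps(1) in auto)
    show "W (\<alpha>(a := v))" if "U \<alpha>" "\<alpha> x" "\<not> \<alpha> y" for \<alpha>
      by (rule hero.prems(12)[OF U[OF that(1)]]) (use that(2,3) hero.prems(8) hero.hyps(1) in auto)
  qed (use hero.prems(1,2,4-8) in auto)
  moreover have "(A - {a}) \<union> (B \<union> {x, y, z}) = A \<union> (B \<union> {x, y, z}) - {a}"
    using hero.prems(1,2,4-8) hero.hyps by auto
  ultimately show ?case using hero.hyps by (auto intro: wins.hero[of a _ _ v])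
next
  case (opp A V)
  have fin: "finite A" "finite B" "card (B \<union> {x, y, z}) = card B + 3" "odd (card A)"
    using opp.prems(1,2,4-8) by auto
  have V: "wins False A V" by (rule wins.opp) (use opp.hyps in auto)
  \<comment> \<open>\<open>D\<close> is what remains outside \<open>A\<close> after T and F have
    used up \<open>x\<close> and \<open>d\<close>. It is even because \<open>B\<close> is odd, so it
    can be treated as irrelevant.\<close>
  have Vx: "wins False (A \<union> D) (\<lambda>\<alpha>. W (\<alpha>(x := False, d := v)))"
    if D: "D = B \<union> {x, y, z} - {x} - {d}" "d \<in> B \<union> {x, y, z} - {x}" for D d v
  proof -
    have "wins False (A \<union> D) V"
    proof (rule wins_dummies[OF V])
      have "card (B \<union> {x, y, z} - {x}) = card B + 2" using fin by (subst card_Diff_singleton) auto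
      then have "card D + 1 = card B + 2" using D fin by (simp add: card_Diff_singleton)
      then show "even (card D)" using opp.prems(5) by presburger
      fix \<alpha> \<beta> assume *: "\<And>a. a \<notin> D \<Longrightarrow> \<alpha> a = \<beta> a" "V \<alpha>"
      show "V \<beta>" by (rule opp.prems(9)[OF _ *(2)], rule *(1)) (use D in auto)
    qed (use fin D opp.prems(1,2,4-8) in auto)
    then show ?thesis
    proof (rule wins_mono)
      fix \<alpha> assume "V \<alpha>"
      then have "V (\<alpha>(x := False, d := v))" by (rule opp.prems(9)[rotated]) (use D in auto)
      then show "W (\<alpha>(x := False, d := v))" by (rule opp.prems(11)) (use D in auto)
    qed
  qed
  show ?case
  proof (rule wins.opp)
    fix a v assume "a \<in> A \<union> (B \<union> {x, y, z})"
    then consider "a \<in> A" | "a = x" "\<not> v" | "a = x" v | "a \<in> B \<union> {x, y, z} - {x}" by blast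
    then show "wins True (A \<union> (B \<union> {x, y, z}) - {a}) (\<lambda>\<alpha>. W (\<alpha>(a := v)))"
    proof cases
      case 1
      have V: "V (\<beta>(a := v))"
        if "\<And>c. c \<notin> B \<union> {x, y, z} \<Longrightarrow> \<alpha> c = \<beta> c" "V (\<alpha>(a := v))" for \<alpha> \<beta>
        by (rule opp.prems(9)[OF _ that(2)]) (use that(1) in auto)
      have U: "U (\<alpha>(a := v))" if "U \<alpha>" for \<alpha>
        by (rule opp.prems(10)[OF _ that]) (use opp.prems(1,2,4-8) 1 in auto)
      have "wins True ((A - {a}) \<union> (B \<union> {x, y, z})) (\<lambda>\<alpha>. W (\<alpha>(a := v)))"
      proof (rule opp.IH[OF 1 _ _ opp.prems(3-5) _ opp.prems(7) _ V opp.prems(10)])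
        show "True \<longleftrightarrow> even (card (A - {a}))" using fin(1,4) 1
          by (metis card_Suc_Diff1 even_Suc)
        show "W (\<alpha>(a := v))" if "V (\<alpha>(a := v))" "\<not> \<alpha> x" for \<alpha>
          by (rule opp.prems(11)[OF that(1)]) (use that(2) opp.prems(8) 1 in auto)
        show "W (\<alpha>(a := v))" if "U \<alpha>" "\<alpha> x" "\<not> \<alpha> y" for \<alpha>
          by (rule opp.prems(12)[OF U[OF that(1)]]) (use that(2,3) opp.prems(8) 1 in auto)
      qed (use opp.prems(1,2,4-8) in auto)
      moreover have "(A - {a}) \<union> (B \<union> {x, y, z}) = A \<union> (B \<union> {x, y, z}) - {a}"
        using opp.prems(1,2,4-8) 1 by auto
      ultimately show ?thesis by simp
    next
      case 2
      \<comment> \<open>T has set \<open>x\<close> to False unasked; F's reply on \<open>y\<close>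
        is a mere waiting move.\<close>
      have "wins False (A \<union> (B \<union> {x, y, z} - {x} - {y})) (\<lambda>\<alpha>. W (\<alpha>(x := False, y := False)))"
        using Vx[OF refl, of y False] opp.prems(7) by simp
      moreover have "(\<lambda>\<alpha>. W (\<alpha>(x := False, y := False))) = (\<lambda>\<alpha>. W (\<alpha>(y := False, x := False)))"
        using opp.prems(7) by (simp add: fun_upd_twist del: fun_upd_apply)
      moreover have "A \<union> (B \<union> {x, y, z} - {x} - {y}) = A \<union> (B \<union> {x, y, z}) - {x} - {y}"
        using opp.prems(8) by auto
      ultimately show ?thesis using 2 opp.prems(7) by (intro wins.hero[of y _ _ False]) auto
    next
      case 3
      \<comment> \<open>\<open>A\<close> has an odd number of free variables here, and
        \<open>z\<close> makes up the even number.\<close>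
      have U: "wins False (B \<union> insert z A) U"
      proof (rule wins_dummies[OF opp.prems(3)])
        fix \<alpha> \<beta> assume *: "\<And>a. a \<notin> insert z A \<Longrightarrow> \<alpha> a = \<beta> a" "U \<alpha>"
        show "U \<beta>" by (rule opp.prems(10)[OF _ *(2)], rule *(1)) (use opp.prems(1,2,4-8) in auto)
      qed (use opp.prems(1,2,4-8) fin in auto)
      have "wins False (B \<union> insert z A) (\<lambda>\<alpha>. W (\<alpha>(y := False, x := True)))"
      proof (rule wins_mono[OF U])
        fix \<alpha> assume "U \<alpha>"
        then have "U (\<alpha>(y := False, x := True))"
          by (rule opp.prems(10)[rotated]) (use opp.prems(1,2,4-8) in auto)
        then show "W (\<alpha>(y := False, x := True))"
          by (rule opp.prems(12)) (use opp.prems(7) in auto)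
      qed
      moreover have "B \<union> insert z A = A \<union> (B \<union> {x, y, z}) - {x} - {y}"
        using opp.prems(7,8) by auto
      ultimately show ?thesis using 3 opp.prems(7) by (intro wins.hero[of y _ _ False]) auto
    next
      case 4
      have "A \<union> (B \<union> {x, y, z} - {x} - {a}) = A \<union> (B \<union> {x, y, z}) - {a} - {x}"
        using opp.prems(6,8) 4 by auto
      moreover have "(\<lambda>\<alpha>. W (\<alpha>(x := False, a := v))) = (\<lambda>\<alpha>. W (\<alpha>(a := v, x := False)))"
        using 4 by (simp add: fun_upd_twist del: fun_upd_apply)
      ultimately show ?thesis using Vx[OF refl 4, of v] 4
        by (intro wins.hero[of x _ _ False]) auto
    qed
  qed auto
qed

lemma satisfies_cong:
  assumes "cnf_vars \<phi> \<subseteq> A" "\<And>a. a \<in> A \<Longrightarrow> \<alpha> a = \<beta> a"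
  shows "satisfies \<alpha> \<phi> \<longleftrightarrow> satisfies \<beta> \<phi>"
proof -
  have "\<alpha> (fst l) = \<beta> (fst l)" if "C \<in> \<phi>" "l \<in> C" for C l
    using that assms unfolding cnf_vars_def by blast
  then show ?thesis unfolding satisfies_iff by (intro ball_cong bex_cong refl) simp
qed

lemma k_uniform_insert:
  assumes "k_uniform k \<phi>" "x \<notin> cnf_vars \<phi>"
  shows "k_uniform (Suc k) (insert (x, b) ` \<phi>)"
  unfolding k_uniform_def
proof
  fix D assume "D \<in> insert (x, b) ` \<phi>"
  then obtain C where C: "C \<in> \<phi>" "D = insert (x, b) C" by auto
  have "x \<notin> fst ` C" using C assms(2) by (auto simp: cnf_vars_def)
  moreover from this have "(x, b) \<notin> C" by force
  ultimately show "finite D \<and> card D = Suc k \<and> card (fst ` D) = Suc k"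
    using assms(1) C by (auto simp: k_uniform_def)
qed

lemma cnf_vars_insert: "cnf_vars (insert (x, b) ` \<phi>) \<subseteq> insert x (cnf_vars \<phi>)"
  by (auto simp: cnf_vars_def)

lemma satisfies_insert:
  "satisfies \<alpha> (insert (x, b) ` \<phi>) \<longleftrightarrow> \<alpha> x = b \<or> satisfies \<alpha> \<phi>"
  by (auto simp: satisfies_iff)

lemma satisfies_Un: "satisfies \<alpha> (\<phi> \<union> \<psi>) \<longleftrightarrow> satisfies \<alpha> \<phi> \<and> satisfies \<alpha> \<psi>"
  by (auto simp: satisfies_def)

text \<open>The bound \<open>N\<close> lets the two recursive instances be placed on disjoint
  variables: \<open>N\<close>, \<open>N + 1\<close>, \<open>N + 2\<close> become \<open>x\<close>,
  \<open>y\<close>, \<open>z\<close>, then comes \<open>A\<close>, and \<open>B\<close> lies above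
  all of \<open>A\<close>. The base formulas are unsatisfiable, with 1 and 2 clauses; for width 0
  one variable is kept so that the number of variables is odd.\<close>

lemma exists_F_winning_instance:
  "\<exists>\<phi> X. finite X \<and> odd (card X) \<and> X \<subseteq> {N..} \<and> cnf_vars \<phi> \<subseteq> X \<and> finite \<phi> \<and> k_uniform k \<phi> \<and>
    card \<phi> \<le> fib (k + 2) \<and> wins False X (\<lambda>\<alpha>. \<not> satisfies \<alpha> \<phi>)"
proof (induction k arbitrary: N rule: fib.induct)
  case 1
  show ?case
    by (rule exI[of _ "{{}}"], rule exI[of _ "{N}"])
      (auto simp: cnf_vars_def k_uniform_def satisfies_def intro!: wins_always)
next
  case 2
  show ?case
    by (rule exI[of _ "{{(N, True)}, {(N, False)}}"], rule exI[of _ "{N}"])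
      (auto simp: cnf_vars_def k_uniform_def satisfies_def numeral_3_eq_3 intro!: wins_always)
next
  case (3 k)
  obtain \<phi> A where A: "finite A" "odd (card A)" "A \<subseteq> {N + 3..}" "cnf_vars \<phi> \<subseteq> A" "finite \<phi>"
    "k_uniform (Suc k) \<phi>" "card \<phi> \<le> fib (Suc k + 2)" "wins False A (\<lambda>\<alpha>. \<not> satisfies \<alpha> \<phi>)"
    using 3(1) by meson
  obtain M' where "\<forall>a\<in>A. a < M'" using A(1) finite_nat_set_iff_bounded by auto
  then obtain M where M: "N + 3 \<le> M" "A \<subseteq> {..<M}" by (intro that[of "max (N + 3) M'"]) auto
  obtain \<psi> B where B: "finite B" "odd (card B)" "B \<subseteq> {M..}" "cnf_vars \<psi> \<subseteq> B" "finite \<psi>"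
    "k_uniform k \<psi>" "card \<psi> \<le> fib (k + 2)" "wins False B (\<lambda>\<alpha>. \<not> satisfies \<alpha> \<psi>)"
    using 3(2) by meson
  define x y z where xyz: "x = N" "y = N + 1" "z = N + 2"
  define \<phi>' where "\<phi>' = insert (x, True) ` \<phi>"
  define \<psi>' where "\<psi>' = insert (x, False) ` insert (y, True) ` \<psi>"
  define X where "X = A \<union> (B \<union> {x, y, z})"
  have AB: "A \<inter> B = {}" using M B(3) by force
  have nA: "x \<notin> A" "y \<notin> A" "z \<notin> A" using A(3) xyz by auto
  have nB: "x \<notin> B" "y \<notin> B" "z \<notin> B" using B(3) M(1) xyz by auto
  have d: "x \<noteq> y" "x \<noteq> z" "y \<noteq> z" using xyz by auto
  have "wins False X (\<lambda>\<alpha>. \<not> satisfies \<alpha> (\<phi>' \<union> \<psi>'))"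
    unfolding X_def
  proof (rule wins_combine[OF A(8,1) _ B(8,1,2) AB])
    fix \<alpha> \<beta> assume *: "\<And>a. a \<notin> B \<union> {x, y, z} \<Longrightarrow> \<alpha> a = \<beta> a" "\<not> satisfies \<alpha> \<phi>"
    have "satisfies \<alpha> \<phi> \<longleftrightarrow> satisfies \<beta> \<phi>"
      by (rule satisfies_cong[OF A(4)], rule *(1)) (use AB nA in auto)
    then show "\<not> satisfies \<beta> \<phi>" using *(2) by simp
  next
    fix \<alpha> \<beta> assume *: "\<And>a. a \<in> B \<Longrightarrow> \<alpha> a = \<beta> a" "\<not> satisfies \<alpha> \<psi>"
    then show "\<not> satisfies \<beta> \<psi>" using satisfies_cong[OF B(4)] by blast
  qed (use A(2) nA nB d in \<open>auto simp: \<phi>'_def \<psi>'_def satisfies_Un satisfies_insert\<close>)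
  moreover have "card (\<phi>' \<union> \<psi>') \<le> fib (Suc (Suc k) + 2)"
  proof -
    have "card (\<phi>' \<union> \<psi>') \<le> card \<phi>' + card \<psi>'" by (rule card_Un_le)
    also have "\<dots> \<le> card \<phi> + card \<psi>"
      unfolding \<phi>'_def \<psi>'_def using A(5) B(5)
      by (intro add_mono card_image_le order_trans[OF card_image_le card_image_le]) auto
    finally show ?thesis using A(7) B(7) by simp
  qed
  moreover have "k_uniform (Suc (Suc k)) (\<phi>' \<union> \<psi>')"
  proof -
    have "x \<notin> cnf_vars (insert (y, True) ` \<psi>)" "y \<notin> cnf_vars \<psi>" "x \<notin> cnf_vars \<phi>"
      using cnf_vars_insert[of y True \<psi>] A(4) B(4) nA nB d by auto
    then have "k_uniform (Suc (Suc k)) \<phi>'" "k_uniform (Suc (Suc k)) \<psi>'"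
      unfolding \<phi>'_def \<psi>'_def using A(6) B(6) by (auto intro!: k_uniform_insert)
    then show ?thesis by (auto simp: k_uniform_def)
  qed
  moreover have "cnf_vars (\<phi>' \<union> \<psi>') \<subseteq> X"
  proof -
    have "cnf_vars \<phi>' \<subseteq> X" "cnf_vars \<psi>' \<subseteq> X"
      using cnf_vars_insert[of x True \<phi>] cnf_vars_insert[of x False "insert (y, True) ` \<psi>"]
        cnf_vars_insert[of y True \<psi>] A(4) B(4)
      unfolding X_def \<phi>'_def \<psi>'_def by blast+
    then show ?thesis by (simp add: cnf_vars_def image_Un)
  qed
  moreover have "card X = card A + card B + 3"
    unfolding X_def using A(1) B(1) AB nA nB d by (subst card_Un_disjoint) auto
  then have "odd (card X)" using A(2) B(2) by simp
  moreover have "X \<subseteq> {N..}"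
  proof -
    have "A \<subseteq> {N..}" "B \<subseteq> {N..}" using A(3) B(3) M(1) by (force)+
    then show ?thesis by (auto simp: X_def xyz)
  qed
  moreover have "finite X" "finite (\<phi>' \<union> \<psi>')"
    using A(1,5) B(1,5) by (auto simp: X_def \<phi>'_def \<psi>'_def)
  ultimately show ?case by blast
qed

theorem theorem2:
  fixes k :: nat
  shows "(1.5::real) ^ k \<le> real (min_clauses k PlayerT PlayerT) \<and>
         min_clauses k PlayerT PlayerT \<le> fib (k + 2)"
proof -
  define S where "S = {card \<phi> | \<phi> X. game_instance \<phi> X \<and> k_uniform k \<phi> \<and>
    X \<noteq> {} \<and> mover PlayerT (card X - 1) = PlayerT \<and> F_has_winning_strategy \<phi> X PlayerT}"
  have min: "min_clauses k PlayerT PlayerT = Inf S" by (simp add: S_def min_clauses_def)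
  obtain \<phi> X where *: "finite X" "odd (card X)" "cnf_vars \<phi> \<subseteq> X" "k_uniform k \<phi>"
    "card \<phi> \<le> fib (k + 2)" "wins False X (\<lambda>\<alpha>. \<not> satisfies \<alpha> \<phi>)"
    using exists_F_winning_instance[of 0 k] by auto
  then have S: "card \<phi> \<in> S"
    using wins_F_has_winning_strategy[OF *(6)]
    by (auto simp: S_def game_instance_def mover_def intro!: exI[of _ \<phi>] exI[of _ X])
  \<comment> \<open>The instance just built makes \<open>S\<close> nonempty, so its infimum is
    attained and the lower bound on members of \<open>S\<close> applies to it.\<close>
  then have "Inf S \<in> S" by (intro Inf_nat_def1) auto
  moreover have "(3 / 2) ^ k \<le> real n" if "n \<in> S" for n
    using that F_winning_card_ge unfolding S_def by blast
  ultimately have "(3 / 2) ^ k \<le> real (Inf S)" by blast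
  moreover have "Inf S \<le> fib (k + 2)" using cInf_lower[OF S] *(5) by simp
  ultimately show ?thesis by (simp add: min)
qed

end
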